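(* Let $A,H,K$ be three events, with $A$ logically independent from both $H$ and $K$ (i.e. $A,H$ are logically independent and $A,K$ are logically independent), with $H\neq\emptyset$, $K\neq\emptyset$, $HK=\emptyset$. The set $\Pi$ of all coherent assessments $(x,y,z)$ on the family $\mathcal F=\{A|H,\ A|K,\ (A|H)\wedge(A|K)\}$ is given by $$\Pi=\{(x,y,z):\ (x,y)\in[0,1]^2,\ z=xy\}.$$
   Context: **Events.** Events are subsets of a set $\Omega$ of elementary outcomes; $\overline{E}$ is the complement of $E$, juxtaposition $EF$ denotes intersection, $\vee$ denotes union, and an event is true at an outcome belonging to it. Events $E_1,\dots,E_n$ are logically independent if all $2^n$ intersections $E_1^*\cdots E_n^*$, with $E_i^*\in\{E_i,\overline{E}_i\}$, are nonempty. **Conditional events.** For $H\neq\emptyset$ and an assessed probability $P(A|H)=x$, the conditional event $A|H$ is identified with the random quantity equal to $1$ on $AH$, $0$ on $\overline{A}H$, and $x$ on $\overline{H}$. It is a conditional random quantity with conditioning event $H$ and prevision $x$. **Conjunction.** Given $P(A|H)=x$, $P(A|K)=y$, the conjunction $(A|H)\wedge(A|K)$, with prevision $z=\mathbb{P}[(A|H)\wedge(A|K)]$, is the random quantity equal to: $1$ on $AHK$; $0$ on $\overline{A}H\vee\overline{A}K$; $x$ on $\overline{H}AK$; $y$ on $AH\overline{K}$; $z$ on $\overline{H}\,\overline{K}$ (cases corresponding to empty events do not occur). It is a conditional random quantity with conditioning event $H\vee K$ and prevision $z$. **Coherence.** Let $\mathcal F=\{X_1|H_1,\dots,X_n|H_n\}$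 be a finite family of conditional random quantities, where $X_i$ takes finitely many real values when the conditioning event $H_i\ne\emptyset$ is true, and let $\mathcal M=(\mu_1,\dots,\mu_n)\in\mathbb R^n$ be a (prevision) assessment, $\mu_i=\mathbb P(X_i|H_i)$. Let $C_1,\dots,C_m$ be the constituents contained in $H_1\vee\cdots\vee H_n$, i.e. the nonempty atoms of the finite partition generated by the events $H_i$ and the events $(X_i=\text{value})\cap H_i$. To $C_h$ associate $Q_h=(q_{h1},\dots,q_{hn})$, where $q_{hi}$ is the value of $X_i$ on $C_h$ if $C_h\subseteq H_i$, and $q_{hi}=\mu_i$ if $C_h\subseteq\overline{H}_i$. Let $S$ be the set of vectors $(\lambda_1,\dots,\lambda_m)$ with $\lambda_h\ge 0$, $\sum_h\lambda_h=1$, $\sum_h\lambda_hQ_h=\mathcal M$, and, when $S\neq\emptyset$, let $I_0=\{i:\max_{\Lambda\in S}\sum_{h:C_h\subseteq H_i}\lambda_h=0\}$. Then $\mathcal M$ is coherent on $\mathcal F$ if and only if (i) $S\neq\emptyset$, and (ii) if $I_0\ne\emptyset$, then the sub-assessment $(\mu_i,\ i\in I_0)$ on $\{X_i|H_i,\ i\in I_0\}$ is coherent (the recursion terminates because $I_0$ is a proper subset of $\{1,\dots,n\}$). *)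

theory Defs
  imports Complex_Main "HOL-Library.FuncSet"
begin

definition logically_independent :: "'w set list \<Rightarrow> bool" where
  "logically_independent Es \<longleftrightarrow>
     (\<forall>S \<subseteq> {..<length Es}. (\<Inter>i<length Es. if i \<in> S then Es ! i else - (Es ! i)) \<noteq> {})"

text \<open>
  A conditional random quantity \<open>X | H\<close>. Coherence only looks at the values of \<open>X\<close> on \<open>H\<close>;
  off \<open>H\<close> the random quantity is its prevision.
\<close>

datatype 'w crq = CRQ (quantity: "'w \<Rightarrow> real") (conditioning: "'w set")

definition cond_event :: "'w set \<Rightarrow> 'w set \<Rightarrow> real \<Rightarrow> 'w crq" where
  "cond_event A H x =
     CRQ (\<lambda>w. if w \<in> A \<inter> H then 1 else if w \<in> - A \<inter> H then 0 else x) H"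

text \<open>
  The conjunction \<open>(A | H) \<and> (A | K)\<close>, where \<open>x\<close>, \<open>y\<close>, \<open>z\<close> are the previsions of
  \<open>A | H\<close>, \<open>A | K\<close> and of the conjunction itself. The listed cases are disjoint and exhaustive,
  so the order of the tests is immaterial and the last branch is \<open>- H \<inter> - K\<close>.
\<close>

definition conjunction :: "'w set \<Rightarrow> 'w set \<Rightarrow> 'w set \<Rightarrow> real \<Rightarrow> real \<Rightarrow> real \<Rightarrow> 'w crq" where
  "conjunction A H K x y z =
     CRQ (\<lambda>w. if w \<in> A \<inter> H \<inter> K then 1
              else if w \<in> (- A \<inter> H) \<union> (- A \<inter> K) then 0
              else if w \<in> - H \<inter> A \<inter> K then x
              else if w \<in> A \<inter> H \<inter> - K then y
              else z) (H \<union> K)"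

definition atoms :: "'w set set \<Rightarrow> 'w set set" where
  "atoms G = {C. C \<noteq> {} \<and> (\<exists>T \<subseteq> G. C = \<Inter>T \<inter> (\<Inter>E \<in> G - T. - E))}"

text \<open>
  In what follows \<open>F\<close> is a family of conditional random quantities, \<open>m\<close> a prevision
  assessment, and \<open>I\<close> the finite set of indices of the (sub)family under consideration.
\<close>

definition generating_events :: "('i \<Rightarrow> 'w crq) \<Rightarrow> 'i set \<Rightarrow> 'w set set" where
  "generating_events F I =
     {conditioning (F i) | i. i \<in> I} \<union>
     {{w \<in> conditioning (F i). quantity (F i) w = v} | i v.
        i \<in> I \<and> v \<in> quantity (F i) ` conditioning (F i)}"

definition constituents :: "('i \<Rightarrow> 'w crq) \<Rightarrow> 'i set \<Rightarrow> 'w set set" where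
  "constituents F I =
     {C \<in> atoms (generating_events F I). C \<subseteq> (\<Union>i\<in>I. conditioning (F i))}"

text \<open>
  The coordinates of the point associated with a constituent \<open>C\<close>. On a constituent contained
  in the conditioning event the quantity is constant, so the image is a singleton.
\<close>

definition q_coord :: "('i \<Rightarrow> 'w crq) \<Rightarrow> ('i \<Rightarrow> real) \<Rightarrow> 'w set \<Rightarrow> 'i \<Rightarrow> real" where
  "q_coord F m C i =
     (if C \<subseteq> conditioning (F i) then the_elem (quantity (F i) ` C) else m i)"

definition weight_solutions ::
    "('i \<Rightarrow> 'w crq) \<Rightarrow> ('i \<Rightarrow> real) \<Rightarrow> 'i set \<Rightarrow> ('w set \<Rightarrow> real) set" where
  "weight_solutions F m I =
     {l \<in> constituents F I \<rightarrow>\<^sub>E {0..}.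
        (\<Sum>C\<in>constituents F I. l C) = 1 \<and>
        (\<forall>i\<in>I. (\<Sum>C\<in>constituents F I. l C * q_coord F m C i) = m i)}"

text \<open>
  The index set \<open>I\<^sub>0\<close>. The weights range over a compact set, so the supremum is a maximum.
\<close>

definition null_indices :: "('i \<Rightarrow> 'w crq) \<Rightarrow> ('i \<Rightarrow> real) \<Rightarrow> 'i set \<Rightarrow> 'i set" where
  "null_indices F m I =
     {i \<in> I. (SUP l \<in> weight_solutions F m I.
                \<Sum>C | C \<in> constituents F I \<and> C \<subseteq> conditioning (F i). l C) = 0}"

text \<open>
  The recursive characterization of coherence is \<open>coherent_on.simps\<close>; it has a unique solution
  on finite index sets by \<open>null_indices_psubset\<close> below. Families with an empty
  conditioning event, or with infinitely many values on a conditioning event, are never coherent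
  in this sense (no weight vector of total mass 1 is found at some stage).
\<close>

inductive coherent_on :: "('i \<Rightarrow> 'w crq) \<Rightarrow> ('i \<Rightarrow> real) \<Rightarrow> 'i set \<Rightarrow> bool"
  for F :: "'i \<Rightarrow> 'w crq" and m :: "'i \<Rightarrow> real" where
  "coherent_on F m I"
    if "weight_solutions F m I \<noteq> {}"
      and "null_indices F m I \<noteq> {} \<longrightarrow> coherent_on F m (null_indices F m I)"

definition coherent_assessment :: "'w crq list \<Rightarrow> real list \<Rightarrow> bool" where
  "coherent_assessment Fs ms \<longleftrightarrow>
     length ms = length Fs \<and> coherent_on ((!) Fs) ((!) ms) {..<length Fs}"

lemma constituent_cases:
  assumes "C \<in> constituents F I" and "i \<in> I"
  shows "C \<subseteq> conditioning (F i) \<or> C \<subseteq> - conditioning (F i)"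
proof -
  obtain T where T: "T \<subseteq> generating_events F I"
      "C = \<Inter>T \<inter> (\<Inter>E \<in> generating_events F I - T. - E)"
    using assms(1) unfolding constituents_def atoms_def by blast
  have "conditioning (F i) \<in> generating_events F I"
    using assms(2) unfolding generating_events_def by blast
  then show ?thesis using T by blast
qed

lemma null_indices_psubset:
  assumes "weight_solutions F m I \<noteq> {}"
  shows "null_indices F m I \<subset> I"
proof -
  let ?Cs = "constituents F I"
  let ?S = "weight_solutions F m I"
  let ?f = "\<lambda>i l. \<Sum>C | C \<in> ?Cs \<and> C \<subseteq> conditioning (F i). l C"
  obtain l where l: "l \<in> ?S" using assms by blast
  then have sum1: "(\<Sum>C\<in>?Cs. l C) = 1" unfolding weight_solutions_def by blast
  then have fin: "finite ?Cs" by (metis sum.infinite zero_neq_one)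
  have nn: "k C \<ge> 0" if "k \<in> ?S" "C \<in> ?Cs" for k C
    using that unfolding weight_solutions_def by (auto simp: PiE_iff)
  obtain C where C: "C \<in> ?Cs" "l C \<noteq> 0"
    using sum1 by (metis sum.neutral zero_neq_one)
  have "C \<noteq> {}" "C \<subseteq> (\<Union>i\<in>I. conditioning (F i))"
    using C(1) unfolding constituents_def atoms_def by auto
  then obtain w i where i: "i \<in> I" "w \<in> C" "w \<in> conditioning (F i)" by blast
  then have sub: "C \<subseteq> conditioning (F i)" using constituent_cases[OF C(1) i(1)] by blast
  have "0 < l C" using nn[OF l C(1)] C(2) by simp
  also have "l C \<le> ?f i l"
    by (rule member_le_sum) (use C(1) sub nn[OF l] fin in auto)
  also have "\<dots> \<le> (SUP k \<in> ?S. ?f i k)"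
  proof (rule cSUP_upper[OF l])
    have "?f i k \<le> 1" if k: "k \<in> ?S" for k
    proof -
      have "?f i k \<le> (\<Sum>C\<in>?Cs. k C)"
        by (rule sum_mono2) (use fin nn[OF k] in auto)
      then show ?thesis using k unfolding weight_solutions_def by simp
    qed
    then show "bdd_above (?f i ` ?S)" by (auto intro!: bdd_aboveI)
  qed
  finally have "i \<notin> null_indices F m I" unfolding null_indices_def by simp
  then show ?thesis using i(1) unfolding null_indices_def by blast
qed

end

theory Submission
  imports Defs
begin

text \<open>
  On every constituent the coordinates of \<open>Q\<^sub>h\<close> satisfy the linear relation
  \<open>q\<^sub>3 = y * q\<^sub>1 + x * q\<^sub>2 - x * y\<close>, because \<open>q\<^sub>2 = y\<close>, \<open>q\<^sub>3 = q\<^sub>1 * y\<close> on \<open>H\<close> and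
  \<open>q\<^sub>1 = x\<close>, \<open>q\<^sub>3 = x * q\<^sub>2\<close> on \<open>K\<close>. Averaging it with a weight vector that represents
  \<open>(x, y, z)\<close> gives \<open>z = x * y\<close>. Every index leaves the recursion at a stage where its
  conditioning event can receive positive mass, which forces \<open>x\<close> and \<open>y\<close> into the unit interval.
  Conversely, for \<open>z = x * y\<close> the weights \<open>x/2, (1 - x)/2, y/2, (1 - y)/2\<close> on
  \<open>AH, - A \<inter> H, AK, - A \<inter> K\<close> give mass \<open>1/2\<close> to both \<open>H\<close> and \<open>K\<close>, so no second stage is needed.
\<close>

lemma logically_independent_two:
  assumes "logically_independent [A, H]"
  shows "A \<inter> H \<noteq> {}" and "- A \<inter> H \<noteq> {}"
proof -
  have len: "{..<length [A, H]} = {0, 1}" by auto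
  have "(\<Inter>i<length [A, H]. if i \<in> S then [A, H] ! i else - ([A, H] ! i)) \<noteq> {}"
    if "S \<subseteq> {0, 1}" for S
    using assms that unfolding logically_independent_def len by blast
  \<comment> \<open>Index 0 is \<open>A\<close> and index 1 is \<open>H\<close>, so the second
    choice of \<open>S\<close> negates \<open>A\<close> only.\<close>
  from this[of "{0, 1}"] this[of "{1}"]
  show "A \<inter> H \<noteq> {}" and "- A \<inter> H \<noteq> {}" unfolding len by simp_all
qed

section \<open>Atoms as classes of outcomes that no event of \<open>G\<close> separates\<close>

definition atom_of :: "'w set set \<Rightarrow> 'w \<Rightarrow> 'w set" where
  "atom_of G w = {v. \<forall>E\<in>G. v \<in> E \<longleftrightarrow> w \<in> E}"

lemma in_atom_of: "w \<in> atom_of G w"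
  by (simp add: atom_of_def)

lemma atom_of_eqI: "v \<in> atom_of G w \<Longrightarrow> atom_of G v = atom_of G w"
  by (auto simp: atom_of_def)

lemma atom_of_subset_iff:
  assumes "E \<in> G"
  shows "atom_of G w \<subseteq> E \<longleftrightarrow> w \<in> E"
  using assms in_atom_of[of w G] by (auto simp: atom_of_def)

text \<open>A nonempty atom is determined by any of its outcomes \<open>w\<close>, since its sign
  pattern \<open>T\<close> must consist of the events of \<open>G\<close> that contain
  \<open>w\<close>. Questions about atoms can thus be asked at single outcomes.\<close>

lemma atoms_eq_range: "atoms G = range (atom_of G)"
proof (intro equalityI subsetI)
  fix C assume "C \<in> atoms G"
  then obtain T w where "T \<subseteq> G" "C = \<Inter>T \<inter> (\<Inter>E \<in> G - T. - E)" "w \<in> C"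
    unfolding atoms_def by blast
  then have "C = atom_of G w" unfolding atom_of_def by blast
  then show "C \<in> range (atom_of G)" by blast
next
  fix C assume "C \<in> range (atom_of G)"
  then obtain w where C: "C = atom_of G w" by blast
  have "C = \<Inter>{E \<in> G. w \<in> E} \<inter> (\<Inter>E \<in> G - {E \<in> G. w \<in> E}. - E)"
    unfolding C atom_of_def by blast
  moreover have "{E \<in> G. w \<in> E} \<subseteq> G" by blast
  moreover have "C \<noteq> {}" unfolding C using in_atom_of by fast
  ultimately show "C \<in> atoms G" unfolding atoms_def mem_Collect_eq by (intro conjI exI)
qed

lemma finite_atoms: "finite G \<Longrightarrow> finite (atoms G)"
  by (rule finite_subset[of _ "(\<lambda>T. \<Inter>T \<inter> (\<Inter>E \<in> G - T. - E)) ` Pow G"])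
     (auto simp: atoms_def)

section \<open>Constituents and their points, read off at an outcome\<close>

lemma conditioning_in_generating_events:
  "i \<in> I \<Longrightarrow> conditioning (F i) \<in> generating_events F I"
  unfolding generating_events_def by blast

lemma finite_generating_events:
  assumes "finite I" and "\<And>i. i \<in> I \<Longrightarrow> finite (quantity (F i) ` conditioning (F i))"
  shows "finite (generating_events F I)"
proof -
  have "generating_events F I = (\<lambda>i. conditioning (F i)) ` I \<union>
      (\<Union>i\<in>I. (\<lambda>v. {w \<in> conditioning (F i). quantity (F i) w = v}) `
        (quantity (F i) ` conditioning (F i)))"
    unfolding generating_events_def by blast
  then show ?thesis using assms by simp
qed

lemma constituents_eq_image:
  "constituents F I =
    atom_of (generating_events F I) ` (\<Union>i\<in>I. conditioning (F i))" (is "_ = ?a ` ?U")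
proof -
  have subset: "?a w \<subseteq> ?U" if w: "w \<in> ?U" for w
  proof -
    obtain i where i: "i \<in> I" "w \<in> conditioning (F i)" using w by blast
    then have "?a w \<subseteq> conditioning (F i)"
      by (simp add: atom_of_subset_iff conditioning_in_generating_events)
    then show ?thesis using i(1) by blast
  qed
  show ?thesis
  proof (intro equalityI subsetI)
    fix C assume "C \<in> constituents F I"
    then obtain w where "C = ?a w" "C \<subseteq> ?U"
      unfolding constituents_def atoms_eq_range by blast
    moreover from this have "w \<in> ?U" using in_atom_of by (metis subsetD)
    ultimately show "C \<in> ?a ` ?U" by simp
  next
    fix C assume "C \<in> ?a ` ?U"
    then show "C \<in> constituents F I"
      using subset unfolding constituents_def atoms_eq_range by auto
  qed
qed

text \<open>For \<open>w\<close> in the conditioning event, the level set of the quantity through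
  \<open>w\<close> is itself a generating event. The class of \<open>w\<close> stays inside it, so
  the image in \<open>q_coord\<close> is a singleton.\<close>

lemma q_coord_atom_of:
  assumes "i \<in> I"
  shows "q_coord F m (atom_of (generating_events F I) w) i =
    (if w \<in> conditioning (F i) then quantity (F i) w else m i)"
proof (cases "w \<in> conditioning (F i)")
  case True
  let ?C = "atom_of (generating_events F I) w"
  have "{v \<in> conditioning (F i). quantity (F i) v = quantity (F i) w} \<in> generating_events F I"
    using assms True unfolding generating_events_def by blast
  then have "?C \<subseteq> {v \<in> conditioning (F i). quantity (F i) v = quantity (F i) w}"
    by (subst atom_of_subset_iff) (use True in auto)
  then have "?C \<subseteq> conditioning (F i)" "quantity (F i) ` ?C = {quantity (F i) w}"
    using in_atom_of by fast+
  then show ?thesis using True by (simp add: q_coord_def)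
next
  case False
  then show ?thesis
    using atom_of_subset_iff[OF conditioning_in_generating_events[OF assms], of F w]
    by (simp add: q_coord_def)
qed

section \<open>Masses of conditioning events and the stages of the recursion\<close>

abbreviation mass :: "('i \<Rightarrow> 'w crq) \<Rightarrow> 'i set \<Rightarrow> ('w set \<Rightarrow> real) \<Rightarrow> 'i \<Rightarrow> real" where
  "mass F I l i \<equiv> \<Sum>C | C \<in> constituents F I \<and> C \<subseteq> conditioning (F i). l C"

lemma weight_solutions_finite:
  assumes "l \<in> weight_solutions F m I"
  shows "finite (constituents F I)"
proof (rule ccontr)
  assume "infinite (constituents F I)"
  \<comment> \<open>A sum over an infinite set is 0 by convention, which contradicts total mass
    1.\<close>
  then have "sum l (constituents F I) = 0" by simp
  then show False using assms unfolding weight_solutions_def by simp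
qed

lemma weight_solutions_nonneg:
  "l \<in> weight_solutions F m I \<Longrightarrow> C \<in> constituents F I \<Longrightarrow> 0 \<le> l C"
  unfolding weight_solutions_def by (auto simp: PiE_iff)

lemma mass_le_1:
  assumes "l \<in> weight_solutions F m I"
  shows "mass F I l i \<le> 1"
proof -
  have "mass F I l i \<le> sum l (constituents F I)"
    by (rule sum_mono2)
       (use weight_solutions_finite[OF assms] weight_solutions_nonneg[OF assms] in auto)
  then show ?thesis using assms unfolding weight_solutions_def by simp
qed

text \<open>Masses are bounded by 1, so the real supremum in \<open>null_indices\<close> is an upper
  bound for each of them and is positive as soon as one mass is.\<close>

lemma positive_mass_not_null:
  assumes "l \<in> weight_solutions F m I" and "0 < mass F I l i"
  shows "i \<notin> null_indices F m I"
proof -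
  have "bdd_above ((\<lambda>l. mass F I l i) ` weight_solutions F m I)"
    using mass_le_1 by (auto intro!: bdd_aboveI2)
  from cSUP_upper[OF assms(1) this] assms(2) show ?thesis
    unfolding null_indices_def by simp
qed

text \<open>Induction along the recursion: a null index is passed on to the next stage, while an
  index that is not null has nonzero supremum of masses and stops there.\<close>

lemma coherent_on_positive_mass:
  assumes "coherent_on F m I" and "i \<in> I"
  obtains J l where "i \<in> J" "l \<in> weight_solutions F m J" "0 < mass F J l i"
proof -
  have "\<exists>J l. i \<in> J \<and> l \<in> weight_solutions F m J \<and> 0 < mass F J l i"
    using assms
  proof (induction rule: coherent_on.induct)
    case (1 I)
    show ?case
    proof (cases "i \<in> null_indices F m I")
      case True
      then show ?thesis using 1 by blast
    next
      case False
      have "\<exists>l\<in>weight_solutions F m I. mass F I l i \<noteq> 0"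
      proof (rule ccontr)
        assume "\<not> ?thesis"
        \<comment> \<open>The supremum of the constant 0 is 0 because the set of weight vectors is
          nonempty; this would make \<open>i\<close> a null index.\<close>
        then have "(SUP l \<in> weight_solutions F m I. mass F I l i) =
            (SUP l \<in> weight_solutions F m I. 0)"
          by (intro SUP_cong) auto
        then show False using 1 False unfolding null_indices_def by simp
      qed
      then obtain l where l: "l \<in> weight_solutions F m I" "mass F I l i \<noteq> 0" by blast
      moreover have "0 \<le> mass F I l i"
        using weight_solutions_nonneg[OF l(1)] by (intro sum_nonneg) auto
      ultimately show ?thesis using 1 by force
    qed
  qed
  then show ?thesis using that by blast
qed

text \<open>Outside the conditioning event the coordinate is \<open>m i\<close> itself, so those
  constituents drop out of the prevision equation. What remains says that \<open>m i\<close> is the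
  conditional mean; the shift by \<open>c\<close> prepares a comparison with bounds on the
  values.\<close>

lemma weight_solutions_conditioned:
  assumes "l \<in> weight_solutions F m I" and "i \<in> I"
  shows "(\<Sum>C | C \<in> constituents F I \<and> C \<subseteq> conditioning (F i). l C * (q_coord F m C i - c)) =
    (m i - c) * mass F I l i"
proof -
  let ?Cs = "constituents F I"
  let ?P = "{C \<in> ?Cs. C \<subseteq> conditioning (F i)}"
  have sums: "sum l ?Cs = 1" "(\<Sum>C\<in>?Cs. l C * q_coord F m C i) = m i"
    using assms unfolding weight_solutions_def by auto
  have "(\<Sum>C\<in>?P. l C * (q_coord F m C i - m i)) = (\<Sum>C\<in>?Cs. l C * (q_coord F m C i - m i))"
    by (rule sum.mono_neutral_left)
       (use weight_solutions_finite[OF assms(1)] in \<open>auto simp: q_coord_def\<close>)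
  also have "\<dots> = m i - m i * sum l ?Cs"
    by (simp add: right_diff_distrib sum_subtractf sums mult.commute flip: sum_distrib_right)
  finally have "(\<Sum>C\<in>?P. l C * (q_coord F m C i - m i)) = 0" using sums by simp
  moreover have "(\<Sum>C\<in>?P. l C * (q_coord F m C i - c)) =
      (\<Sum>C\<in>?P. l C * (q_coord F m C i - m i)) + (\<Sum>C\<in>?P. (m i - c) * l C)"
    by (simp add: algebra_simps flip: sum.distrib)
  ultimately show ?thesis by (simp add: sum_distrib_left)
qed

text \<open>At a stage where the conditioning event of \<open>i\<close> has positive mass,
  \<open>m i\<close> is a weighted mean of values in \<open>{a..b}\<close>. The shifts
  \<open>c = a\<close> and \<open>c = b\<close> give sums of known sign, and the positive mass can
  be cancelled.\<close>

lemma coherent_on_bounds: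
  assumes coh: "coherent_on F m I" and i: "i \<in> I"
    and bounds: "\<And>w. w \<in> conditioning (F i) \<Longrightarrow> quantity (F i) w \<in> {a..b}"
  shows "m i \<in> {a..b}"
proof -
  obtain J l where J: "i \<in> J" and l: "l \<in> weight_solutions F m J" and pos: "0 < mass F J l i"
    using coherent_on_positive_mass[OF coh i] .
  have q: "q_coord F m C i \<in> {a..b}" "0 \<le> l C"
    if CJ: "C \<in> constituents F J" and C: "C \<subseteq> conditioning (F i)" for C
  proof -
    obtain w where w: "C = atom_of (generating_events F J) w"
      using CJ unfolding constituents_eq_image by blast
    have wF: "w \<in> conditioning (F i)" using C w in_atom_of by (metis subsetD)
    have "q_coord F m C i = quantity (F i) w" unfolding w q_coord_atom_of[OF J] using wF by simp
    then show "q_coord F m C i \<in> {a..b}" using bounds[OF wF] by simp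
    show "0 \<le> l C" using weight_solutions_nonneg[OF l CJ] .
  qed
  have "0 \<le> (m i - a) * mass F J l i"
    unfolding weight_solutions_conditioned[OF l J, of a, symmetric]
    by (rule sum_nonneg) (use q in \<open>auto intro!: mult_nonneg_nonneg\<close>)
  moreover have "(m i - b) * mass F J l i \<le> 0"
    unfolding weight_solutions_conditioned[OF l J, of b, symmetric]
    by (rule sum_nonpos) (use q in \<open>auto intro!: mult_nonneg_nonpos\<close>)
  ultimately show ?thesis
    using pos by (auto simp: zero_le_mult_iff mult_le_0_iff)
qed

text \<open>The image of a distribution on finitely many outcomes is a weight vector on the
  constituents. If it charges every conditioning event, no index is null and the recursion ends at
  the first stage.\<close>

lemma coherent_on_from_distribution:
  fixes p :: "'w \<Rightarrow> real"
  assumes fin: "finite I" "\<And>i. i \<in> I \<Longrightarrow> finite (quantity (F i) ` conditioning (F i))"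
    and W: "finite W" "W \<subseteq> (\<Union>i\<in>I. conditioning (F i))"
    and nonneg: "\<And>w. w \<in> W \<Longrightarrow> 0 \<le> p w"
    and total: "sum p W = 1"
    and prevision: "\<And>i. i \<in> I \<Longrightarrow>
      (\<Sum>w\<in>W. p w * (if w \<in> conditioning (F i) then quantity (F i) w else m i)) = m i"
    and pos: "\<And>i. i \<in> I \<Longrightarrow> 0 < sum p (W \<inter> conditioning (F i))"
  shows "coherent_on F m I"
proof -
  let ?a = "atom_of (generating_events F I)"
  let ?Cs = "constituents F I"
  \<comment> \<open>This is the image of \<open>p\<close> under \<open>?a\<close>; the restriction
    provides the extensionality that \<open>weight_solutions\<close> demands.\<close>
  define l where "l = restrict (\<lambda>C. \<Sum>w\<in>{w \<in> W. ?a w = C}. p w) ?Cs"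
  have finCs: "finite ?Cs"
    using finite_atoms[OF finite_generating_events[OF fin]]
    unfolding constituents_def by simp
  have aW: "?a ` W \<subseteq> ?Cs" using W(2) unfolding constituents_eq_image by blast
  \<comment> \<open>Change of variables, applied below to the constant 1, to the coordinates and to
    the indicator of a conditioning event.\<close>
  have push: "(\<Sum>C\<in>?Cs. l C * g C) = (\<Sum>w\<in>W. p w * g (?a w))" for g
  proof -
    have "(\<Sum>C\<in>?Cs. l C * g C) = (\<Sum>C\<in>?Cs. \<Sum>w\<in>{w \<in> W. ?a w = C}. p w * g (?a w))"
      by (rule sum.cong) (auto simp: l_def sum_distrib_right)
    also have "\<dots> = (\<Sum>w\<in>W. p w * g (?a w))"
      by (rule sum.group[OF W(1) finCs aW])
    finally show ?thesis .
  qed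
  have "l \<in> ?Cs \<rightarrow>\<^sub>E {0..}"
    using nonneg by (auto simp: l_def intro!: sum_nonneg)
  moreover have "sum l ?Cs = 1" using push[of "\<lambda>_. 1"] total by simp
  moreover have "(\<Sum>C\<in>?Cs. l C * q_coord F m C i) = m i" if "i \<in> I" for i
    unfolding push using prevision[OF that] by (simp add: q_coord_atom_of[OF that])
  ultimately have l: "l \<in> weight_solutions F m I" unfolding weight_solutions_def by simp
  have "0 < mass F I l i" if i: "i \<in> I" for i
  proof -
    have "mass F I l i = (\<Sum>C\<in>?Cs. l C * (if C \<subseteq> conditioning (F i) then 1 else 0))"
      by (rule sum.mono_neutral_cong_left) (use finCs in auto)
    also have "\<dots> = (\<Sum>w\<in>W. p w * (if w \<in> conditioning (F i) then 1 else 0))"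
      unfolding push by (simp add: atom_of_subset_iff[OF conditioning_in_generating_events[OF i]])
    also have "\<dots> = sum p (W \<inter> conditioning (F i))"
      by (rule sum.mono_neutral_cong_right) (use W(1) in auto)
    finally show ?thesis using pos[OF i] by simp
  qed
  then have "null_indices F m I = {}"
    using positive_mass_not_null[OF l] unfolding null_indices_def by blast
  then show ?thesis using l by (intro coherent_on.intros) auto
qed

section \<open>The family of two conditional events and their conjunction\<close>

lemma coherent_conjunction_product:
  assumes coh: "coherent_assessment
      [cond_event A H x, cond_event A K y, conjunction A H K x y z] [x, y, z]"
    and disj: "H \<inter> K = {}"
  shows "z = x * y"
proof -
  let ?F = "(!) [cond_event A H x, cond_event A K y, conjunction A H K x y z]"
  let ?m = "(!) [x, y, z]"
  let ?I = "{..<3::nat}"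
  let ?Cs = "constituents ?F ?I"
  have "coherent_on ?F ?m ?I"
    using coh by (simp add: coherent_assessment_def numeral_3_eq_3)
  then obtain l where l: "l \<in> weight_solutions ?F ?m ?I" by cases blast
  have total: "sum l ?Cs = 1"
    and prev: "\<And>i. i < 3 \<Longrightarrow> (\<Sum>C\<in>?Cs. l C * q_coord ?F ?m C i) = ?m i"
    using l unfolding weight_solutions_def by auto
  have relation: "q_coord ?F ?m C 2 = y * q_coord ?F ?m C 0 + x * q_coord ?F ?m C 1 - x * y"
    if CI: "C \<in> ?Cs" for C
  proof -
    obtain w where C: "C = atom_of (generating_events ?F ?I) w"
      and w: "w \<in> (\<Union>i\<in>?I. conditioning (?F i))"
      using CI unfolding constituents_eq_image by blast
    \<comment> \<open>Here the conjunction is conditioned on \<open>H \<union> K\<close>, so its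
      coordinate is a true value (0, \<open>x\<close> or \<open>y\<close>, as \<open>H\<close> and
      \<open>K\<close> are disjoint) and never the default \<open>z\<close>.\<close>
    have "w \<in> H \<union> K"
      using w by (auto simp: less_Suc_eq numeral_3_eq_3 cond_event_def conjunction_def)
    then show ?thesis
      using disj
      by (auto simp: C q_coord_atom_of cond_event_def conjunction_def)
  qed
  have "z = (\<Sum>C\<in>?Cs. l C * q_coord ?F ?m C 2)" using prev[of 2] by simp
  also have "\<dots> = (\<Sum>C\<in>?Cs. y * (l C * q_coord ?F ?m C 0) + x * (l C * q_coord ?F ?m C 1)
      - x * y * l C)"
    by (rule sum.cong) (simp_all add: relation algebra_simps)
  also have "\<dots> = y * (\<Sum>C\<in>?Cs. l C * q_coord ?F ?m C 0)
      + x * (\<Sum>C\<in>?Cs. l C * q_coord ?F ?m C 1) - x * y * sum l ?Cs"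
    by (simp only: sum.distrib sum_subtractf sum_distrib_left)
  also have "\<dots> = x * y" using prev[of 0] prev[of 1] total by simp
  finally show ?thesis .
qed

lemma coherent_conjunction_bounds:
  assumes coh: "coherent_assessment
      [cond_event A H x, cond_event A K y, conjunction A H K x y z] [x, y, z]"
  shows "x \<in> {0..1}" and "y \<in> {0..1}"
proof -
  let ?F = "(!) [cond_event A H x, cond_event A K y, conjunction A H K x y z]"
  have coh': "coherent_on ?F ((!) [x, y, z]) {..<3}"
    using coh by (simp add: coherent_assessment_def numeral_3_eq_3)
  show "x \<in> {0..1}"
    using coherent_on_bounds[OF coh', of 0 0 1] by (auto simp: cond_event_def)
  show "y \<in> {0..1}"
    using coherent_on_bounds[OF coh', of 1 0 1] by (auto simp: cond_event_def)
qed

lemma coherent_product_assessment: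
  assumes ne: "A \<inter> H \<noteq> {}" "- A \<inter> H \<noteq> {}" "A \<inter> K \<noteq> {}" "- A \<inter> K \<noteq> {}"
    and disj: "H \<inter> K = {}"
    and xy: "x \<in> {0..1}" "y \<in> {0..1}"
  shows "coherent_assessment
    [cond_event A H x, cond_event A K y, conjunction A H K x y (x * y)] [x, y, x * y]"
proof -
  let ?F = "(!) [cond_event A H x, cond_event A K y, conjunction A H K x y (x * y)]"
  let ?m = "(!) [x, y, x * y]"
  \<comment> \<open>One outcome from each of the four cells; disjointness of \<open>H\<close> and
    \<open>K\<close> makes them distinct.\<close>
  obtain a b c d where abcd:
    "a \<in> A" "a \<in> H" "b \<notin> A" "b \<in> H" "c \<in> A" "c \<in> K" "d \<notin> A" "d \<in> K"
    using ne by blast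
  have off: "a \<notin> K" "b \<notin> K" "c \<notin> H" "d \<notin> H"
    using abcd disj by auto
  have neq: "a \<noteq> b" "a \<noteq> c" "a \<noteq> d" "b \<noteq> c" "b \<noteq> d" "c \<noteq> d"
    using abcd off by auto
  define p where "p w = (if w = a then x / 2 else if w = b then (1 - x) / 2
      else if w = c then y / 2 else (1 - y) / 2)" for w
  have p: "p a = x / 2" "p b = (1 - x) / 2" "p c = y / 2" "p d = (1 - y) / 2"
    using neq by (auto simp: p_def)
  have three: "{..<3::nat} = {0, 1, 2}" by auto
  have "coherent_on ?F ?m {..<3}"
  proof (rule coherent_on_from_distribution[where W = "{a, b, c, d}" and p = p])
    fix i :: nat assume "i \<in> {..<3}"
    then consider "i = 0" | "i = 1" | "i = 2" by fastforce
    note i_cases = this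
    show "finite (quantity (?F i) ` conditioning (?F i))"
      \<comment> \<open>The value \<open>x * y\<close> is absent from this set because the
        conjunction takes its last branch only outside \<open>H \<union> K\<close>.\<close>
      by (rule finite_subset[of _ "{0, 1, x, y}"], cases rule: i_cases)
         (auto simp: cond_event_def conjunction_def)
    show "(\<Sum>w\<in>{a, b, c, d}. p w *
        (if w \<in> conditioning (?F i) then quantity (?F i) w else ?m i)) = ?m i"
      by (cases rule: i_cases)
         (use neq abcd off in \<open>simp_all add: p cond_event_def conjunction_def field_simps\<close>)
    \<comment> \<open>The masses are 1/2 on \<open>H\<close>, 1/2 on \<open>K\<close> and 1 on
      \<open>H \<union> K\<close>, whatever \<open>x\<close> and \<open>y\<close> are.\<close>
    show "0 < sum p ({a, b, c, d} \<inter> conditioning (?F i))"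
      by (cases rule: i_cases)
         (use neq abcd off in \<open>simp_all add: p cond_event_def conjunction_def field_simps\<close>)
  qed (use xy neq abcd in \<open>auto simp: p three cond_event_def conjunction_def field_simps\<close>)
  then show ?thesis by (simp add: coherent_assessment_def numeral_3_eq_3)
qed

theorem theorem7:
  fixes A H K :: "'w set"
  assumes "logically_independent [A, H]"
    and "logically_independent [A, K]"
    and "H \<noteq> {}" and "K \<noteq> {}"
    and "H \<inter> K = {}"
  shows "{(x, y, z). coherent_assessment
            [cond_event A H x, cond_event A K y, conjunction A H K x y z] [x, y, z]} =
         {(x, y, z). (x, y) \<in> {0..1} \<times> {0..1} \<and> z = x * y}"
proof -
  note ne = logically_independent_two[OF assms(1)] logically_independent_two[OF assms(2)]
  have "coherent_assessment
        [cond_event A H x, cond_event A K y, conjunction A H K x y z] [x, y, z] \<longleftrightarrow>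
      x \<in> {0..1} \<and> y \<in> {0..1} \<and> z = x * y" for x y z
    using coherent_conjunction_bounds[of A H x K y z]
      coherent_conjunction_product[of A H x K y z, OF _ assms(5)]
      coherent_product_assessment[OF ne assms(5), of x y]
    by blast
  then show ?thesis by simp
qed

end
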